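(* Let $d\geqslant 3$ and $n$ be positive integers with $\gcd(d,n)=1$. Then $$\sum_{k=0}^{n-1}[2dk+1]\frac{(q;q^d)_k^{2d}}{(q^d;q^d)_k^{2d}}\,q^{d(d-2)k}\equiv 0\pmod{\Phi_n(q)}$$ and $$\sum_{k=0}^{n-1}[2dk-1]\frac{(q^{-1};q^d)_k^{2d}}{(q^d;q^d)_k^{2d}}\,q^{d^2k}\equiv 0\pmod{\Phi_n(q)}.$$
   Context: Here $q$ is an indeterminate. The $q$-shifted factorial is $(a;q)_k=(1-a)(1-aq)\cdots(1-aq^{k-1})$, with $(a;q)_0=1$; thus $(q^{r};q^d)_k=\prod_{j=0}^{k-1}(1-q^{r+dj})$. The $q$-integer is $[m]=[m]_q=\frac{1-q^m}{1-q}$ for any integer $m$ (so $[m]=1+q+\cdots+q^{m-1}$ for $m\geqslant 1$ and $[-1]=-q^{-1}$). $\Phi_n(q)=\prod_{1\leqslant k\leqslant n,\ \gcd(n,k)=1}(q-\zeta^k)$, with $\zeta$ a primitive $n$-th root of unity, is the $n$-th cyclotomic polynomial. For rational functions $A(q),B(q)\in\mathbb{Q}(q)$ and a polynomial $P(q)$, the congruence $A(q)\equiv B(q)\pmod{P(q)}$ means that $P(q)$ divides the numerator of $A(q)-B(q)$ written in lowest terms, as polynomials in $q$ over $\mathbb{Q}$.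
   Formalization: The formal theorem assumes n ≥ 2 instead of n positive: for n = 1 the two sums equal [1] = 1 and [-1] = -q^{-1}, and neither is divisible by Φ_1(q) = q - 1, so the claim fails there for every d. *)

theory Defs
  imports
    "HOL-Computational_Algebra.Computational_Algebra"
    "HOL-Computational_Algebra.Field_as_Ring"
begin

section \<open>Rational functions in \<open>q\<close>\<close>

type_synonym ratfun = "rat poly fract"

definition q_var :: ratfun where
  "q_var = to_fract [:0, 1:]"

definition q_pochhammer :: "'a :: comm_ring_1 \<Rightarrow> 'a \<Rightarrow> nat \<Rightarrow> 'a" where
  "q_pochhammer a b k = (\<Prod>j<k. 1 - a * b ^ j)"

definition q_int :: "int \<Rightarrow> ratfun" where
  "q_int m = (1 - q_var powi m) / (1 - q_var)"

text \<open>
  \<^const>\<open>quot_of_fract\<close> returns the coprime numerator and (monic) denominator of a fraction.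
\<close>
definition ratfun_cong :: "ratfun \<Rightarrow> ratfun \<Rightarrow> rat poly \<Rightarrow> bool" where
  "ratfun_cong A B P \<longleftrightarrow> P dvd fst (quot_of_fract (A - B))"


section \<open>Cyclotomic polynomials\<close>

definition cyclotomic_complex :: "nat \<Rightarrow> complex poly" where
  "cyclotomic_complex n =
     (\<Prod>k | k \<in> {1..n} \<and> coprime n k. [:- (cis (2 * pi / real n) ^ k), 1:])"

text \<open>
  The product above has rational coefficients, and \<open>cyclotomic n\<close> is that product seen
  as a polynomial over the rationals; \<open>of_rat_cyclotomic\<close> below shows that the definite
  description is well-defined for \<open>n > 0\<close>.
\<close>
definition cyclotomic :: "nat \<Rightarrow> rat poly" where
  "cyclotomic n = (THE p. map_poly of_rat p = cyclotomic_complex n)"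

lemma map_poly_of_rat_mult:
  "map_poly of_rat (p * r) =
     (map_poly of_rat p * map_poly of_rat r :: 'a :: field_char_0 poly)"
  by (rule poly_eqI) (simp add: coeff_map_poly coeff_mult of_rat_sum of_rat_mult)

lemma map_poly_of_rat_add:
  "map_poly of_rat (p + r) =
     (map_poly of_rat p + map_poly of_rat r :: 'a :: field_char_0 poly)"
  by (rule poly_eqI) (simp add: coeff_map_poly of_rat_add)

lemma map_poly_of_rat_prod:
  "map_poly of_rat (\<Prod>x\<in>A. f x) =
     (\<Prod>x\<in>A. map_poly of_rat (f x) :: 'a :: field_char_0 poly)"
  by (induction A rule: infinite_finite_induct) (simp_all add: map_poly_of_rat_mult)

lemma map_poly_of_rat_inject:
  "map_poly of_rat p = (map_poly of_rat r :: 'a :: field_char_0 poly) \<longleftrightarrow> p = r"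
  by (auto simp: poly_eq_iff coeff_map_poly)

lemma degree_map_poly_of_rat:
  "degree (map_poly of_rat p :: 'a :: field_char_0 poly) = degree p"
  by (rule degree_map_poly) auto

lemma cyclotomic_complex_nonzero: "cyclotomic_complex n \<noteq> 0"
  by (simp add: cyclotomic_complex_def)

lemma prod_linear_roots_unity:
  assumes "n > 0"
  shows   "(\<Prod>k\<in>{1..n}. [:- (cis (2 * pi / real n) ^ k), 1:]) = monom 1 n - 1"
proof -
  let ?z = "\<lambda>k. cis (2 * pi / real n) ^ k"
  let ?P = "\<Prod>k\<in>{1..n}. [:- ?z k, 1:]"
  let ?U = "{z :: complex. z ^ n = 1}"
  have cis: "?z k = cis (2 * pi * real k / real n)" for k
    by (simp add: DeMoivre field_simps)
  have z1: "?z n = 1"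
    using assms by (simp add: cis)
  have deg: "degree ?P = n"
    by (subst degree_prod_eq_sum_degree) auto
  have lead: "coeff ?P n = 1"
    using lead_coeff_prod[of "\<lambda>k. [:- ?z k, 1:]" "{1..n}"] deg by simp
  have lead': "coeff (monom 1 n - 1 :: complex poly) n = 1"
    using assms by (simp add: coeff_eq_0)
  have "degree (monom 1 n - 1 :: complex poly) \<le> n"
    by (intro degree_diff_le) (auto simp: degree_monom_le)
  moreover have "poly ?P z = poly (monom 1 n - 1) z" if z: "z \<in> ?U" for z
  proof -
    obtain k where k: "k < n" "z = ?z k"
      using bij_betw_imp_surj_on[OF bij_betw_roots_unity[OF assms]] z
      by (metis (no_types, lifting) cis imageE lessThan_iff)
    define k' where "k' = (if k = 0 then n else k)"
    have "k' \<in> {1..n}" "z = ?z k'"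
      using k z1 assms by (auto simp: k'_def)
    hence "poly ?P z = 0"
      by (auto simp: poly_prod)
    with z show ?thesis by (simp add: poly_monom)
  qed
  moreover have "card ?U = n"
    using assms by (rule card_roots_unity_eq)
  ultimately show ?thesis
    using deg lead lead' by (intro poly_eqI_degree_lead_coeff[of _ n _ ?U]) auto
qed

lemma prod_cyclotomic_complex:
  assumes "n > 0"
  shows   "(\<Prod>m | m dvd n. cyclotomic_complex m) = monom 1 n - 1"
proof -
  let ?T = "\<lambda>m. {k. k \<in> {1..m} \<and> coprime m k}"
  let ?f = "\<lambda>(m, k). k * (n div m)"
  let ?g = "\<lambda>j. (n div gcd n j, j div gcd n j)"
  have bij: "bij_betw ?f (SIGMA m:{m. m dvd n}. ?T m) {1..n}"
  proof (rule bij_betw_byWitness[where f' = ?g])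
    show "\<forall>x\<in>(SIGMA m:{m. m dvd n}. ?T m). ?g (?f x) = x"
    proof
      fix x assume "x \<in> (SIGMA m:{m. m dvd n}. ?T m)"
      then obtain m k where x: "x = (m, k)"
        and mk: "m dvd n" "k \<in> {1..m}" "coprime m k"
        by auto
      from mk(1) obtain c where c: "n = m * c" ..
      have pos: "m > 0" "c > 0"
        using c assms by auto
      have "gcd n (k * c) = c"
        using mk(3) gcd_mult_distrib_nat[of c m k] by (simp add: c mult.commute)
      thus "?g (?f x) = x"
        using pos by (simp add: c x)
    qed
    show "\<forall>j\<in>{1..n}. ?f (?g j) = j"
    proof
      fix j assume j: "j \<in> {1..n}"
      obtain a b where ab: "n = gcd n j * a" "j = gcd n j * b"
        by (meson dvdE gcd_dvd1 gcd_dvd2)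
      have "n div (n div gcd n j) = gcd n j"
        using assms by (metis ab(1) mult_0_right nonzero_mult_div_cancel_left
            nonzero_mult_div_cancel_right less_numeral_extra(3) mult_zero_left)
      thus "?f (?g j) = j" by simp
    qed
    show "?f ` (SIGMA m:{m. m dvd n}. ?T m) \<subseteq> {1..n}"
    proof
      fix y assume "y \<in> ?f ` (SIGMA m:{m. m dvd n}. ?T m)"
      then obtain m k where y: "y = k * (n div m)" and mk: "m dvd n" "k \<in> {1..m}"
        by auto
      from mk(1) obtain c where c: "n = m * c" ..
      have "m > 0" "c > 0"
        using c assms by auto
      thus "y \<in> {1..n}"
        using mk(2) by (auto simp: c y Suc_le_eq)
    qed
    show "?g ` {1..n} \<subseteq> (SIGMA m:{m. m dvd n}. ?T m)"
    proof
      fix x assume "x \<in> ?g ` {1..n}"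
      then obtain j where j: "j \<in> {1..n}" and x: "x = (n div gcd n j, j div gcd n j)"
        by auto
      have "n div gcd n j dvd n"
        by (metis dvd_div_mult_self dvd_triv_left gcd_dvd1)
      moreover have "coprime (n div gcd n j) (j div gcd n j)"
        using assms by (intro div_gcd_coprime) auto
      moreover have "0 < j div gcd n j"
        using j by (auto simp: div_greater_zero_iff intro!: gcd_le2_nat)
      moreover have "j div gcd n j \<le> n div gcd n j"
        using j by (auto intro: div_le_mono)
      ultimately show "x \<in> (SIGMA m:{m. m dvd n}. ?T m)"
        by (simp add: x Suc_le_eq)
    qed
  qed
  have "(\<Prod>m | m dvd n. cyclotomic_complex m) =
        (\<Prod>(m, k)\<in>(SIGMA m:{m. m dvd n}. ?T m). [:- (cis (2 * pi / real m) ^ k), 1:])"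
    unfolding cyclotomic_complex_def using assms by (subst prod.Sigma) auto
  also have "\<dots> = (\<Prod>x\<in>(SIGMA m:{m. m dvd n}. ?T m). [:- (cis (2 * pi / real n) ^ ?f x), 1:])"
  proof (rule prod.cong, goal_cases)
    case (2 x)
    then obtain m k where mk: "x = (m, k)" "m dvd n" by auto
    from mk(2) obtain c where c: "n = m * c" ..
    have pos: "m > 0" "c > 0"
      using c assms by auto
    hence "cis (2 * pi / real n) ^ (k * c) = cis (2 * pi / real m) ^ k"
      by (simp add: DeMoivre c field_simps)
    thus ?case using pos by (simp add: mk c)
  qed auto
  also have "\<dots> = (\<Prod>k\<in>{1..n}. [:- (cis (2 * pi / real n) ^ k), 1:])"
    by (rule prod.reindex_bij_betw[OF bij])
  also have "\<dots> = monom 1 n - 1"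
    using assms by (rule prod_linear_roots_unity)
  finally show ?thesis .
qed

lemma cyclotomic_complex_rational:
  assumes "n > 0"
  shows   "\<exists>p. map_poly of_rat p = cyclotomic_complex n"
  using assms
proof (induction n rule: less_induct)
  case (less n)
  let ?D = "{m. m dvd n} - {n}"
  have "\<exists>p. map_poly of_rat p = cyclotomic_complex m" if "m \<in> ?D" for m
    using that less dvd_imp_le[of m n] by (intro less.IH) (auto intro: Nat.gr0I)
  then obtain f where f: "map_poly of_rat (f m) = cyclotomic_complex m" if "m \<in> ?D" for m
    by metis
  define R where "R = (\<Prod>m\<in>?D. f m)"
  define X where "X = (monom 1 n - 1 :: rat poly)"
  let ?h = "map_poly of_rat :: rat poly \<Rightarrow> complex poly"
  have R: "?h R = (\<Prod>m\<in>?D. cyclotomic_complex m)"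
    unfolding R_def map_poly_of_rat_prod by (intro prod.cong refl f)
  have R0: "R \<noteq> 0"
    using R less.prems by (auto simp: prod_zero_iff cyclotomic_complex_nonzero)
  have "?h X = monom 1 n - 1"
    by (rule poly_eqI) (simp add: X_def coeff_map_poly of_rat_diff)
  also have "\<dots> = ?h R * cyclotomic_complex n"
    unfolding R using less.prems
    by (subst prod_cyclotomic_complex[symmetric])
       (simp_all add: prod.remove[of _ n] mult.commute)
  finally have eq: "?h R * cyclotomic_complex n = ?h (R * (X div R) + X mod R)"
    by simp
  hence eq': "?h R * (cyclotomic_complex n - ?h (X div R)) = ?h (X mod R)"
    unfolding map_poly_of_rat_add map_poly_of_rat_mult by (simp add: algebra_simps)
  have "cyclotomic_complex n - ?h (X div R) = 0"
  proof (rule ccontr)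
    assume ne: "cyclotomic_complex n - ?h (X div R) \<noteq> 0"
    have hR: "?h R \<noteq> 0"
      using R0 map_poly_of_rat_inject[of R 0] by auto
    have "X mod R \<noteq> 0"
      using eq' ne hR by auto
    hence "degree (?h (X mod R)) < degree (?h R)"
      using degree_mod_less'[OF R0] by (simp add: degree_map_poly_of_rat)
    thus False
      unfolding eq'[symmetric] using ne hR by (simp add: degree_mult_eq)
  qed
  thus ?case by (metis eq_iff_diff_eq_0)
qed

lemma of_rat_cyclotomic:
  assumes "n > 0"
  shows   "map_poly of_rat (cyclotomic n) = cyclotomic_complex n"
proof -
  obtain p where p: "map_poly of_rat p = cyclotomic_complex n"
    using cyclotomic_complex_rational[OF assms] by blast
  show ?thesis
    unfolding cyclotomic_def by (rule theI[of _ p]) (use p map_poly_of_rat_inject in metis)+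
qed

end

theory Submission
  imports Defs "HOL-Number_Theory.Cong" "HOL-Library.Real_Mod"
begin

text \<open>
  A congruence to zero modulo \<open>\<Phi>\<^sub>n(q)\<close> holds as soon as the rational function is defined and
  vanishes at every primitive \<open>n\<close>-th root of unity \<open>z\<close> (\<open>ratfun_cong_cyclotomicI\<close>), so the
  indeterminate \<open>q\<close> may be replaced by \<open>z\<close>. Put \<open>Q = z\<^sup>d\<close>, which is again a primitive \<open>n\<close>-th
  root of unity because \<open>d\<close> and \<open>n\<close> are coprime; hence no denominator \<open>(Q;Q)\<^sub>k\<close> with \<open>k < n\<close>
  vanishes. Let \<open>a\<close> be \<open>z\<close> in the first sum and \<open>1/z\<close> in the second. Some \<open>m < n\<close> satisfies
  \<open>a Q\<^sup>m = 1\<close>, so that \<open>(a;Q)\<^sub>k\<close> vanishes for \<open>k > m\<close>.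

  For \<open>k \<le> m\<close> the identity \<open>1 - a Q\<^sup>j = - a Q\<^sup>j (1 - Q\<^bsup>m-j\<^esup>)\<close> turns \<open>(a;Q)\<^sub>k / (Q;Q)\<^sub>k\<close> into the
  \<open>Q\<close>-binomial coefficient of \<open>m\<close> and \<open>k\<close>, up to a sign and a power of \<open>Q\<close>. With \<open>w\<close> the
  constant whose \<open>k\<close>-th power ends the summand, both sums satisfy \<open>w a\<^sup>d Q = Q\<^sup>d\<close>; with this
  relation all powers of \<open>Q\<close> combine so that, up to a constant, the summand is
  \<open>(Q\<^bsup>m-k\<^esup> - Q\<^sup>k) Q\<^bsup>-dk(m-k)\<^esup>\<close> times the \<open>2d\<close>-th power of the \<open>Q\<close>-binomial coefficient
  (\<open>well_poised_term\<close>). This changes sign under \<open>k \<mapsto> m - k\<close>, hence the sum is zero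
  (\<open>well_poised_sum_eq_0\<close>).
\<close>

section \<open>Antisymmetry of the terminating sums\<close>

lemma q_pochhammer_0 [simp]: "q_pochhammer a b 0 = 1"
  by (simp add: q_pochhammer_def)

lemma q_pochhammer_Suc:
  "q_pochhammer a b (Suc k) = q_pochhammer a b k * (1 - a * b ^ k)"
  by (simp add: q_pochhammer_def)

lemma q_pochhammer_self_nonzero:
  fixes Q :: "'a :: field"
  assumes "\<And>j. 0 < j \<Longrightarrow> j \<le> k \<Longrightarrow> Q ^ j \<noteq> 1"
  shows   "q_pochhammer Q Q k \<noteq> 0"
proof -
  have "1 - Q * Q ^ j \<noteq> 0" if "j < k" for j
    using assms[of "Suc j"] that by simp
  thus ?thesis by (simp add: q_pochhammer_def)
qed

text \<open>
  As \<open>a = Q\<^bsup>-m\<^esup>\<close>, pulling \<open>- a Q\<^sup>j\<close> out of the factor \<open>1 - a Q\<^sup>j\<close> leaves \<open>1 - Q\<^bsup>m-j\<^esup>\<close>, which is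
  one of the top \<open>k\<close> factors of \<open>(Q;Q)\<^sub>m\<close>.
\<close>
lemma q_pochhammer_reflection:
  fixes a Q :: "'a :: field"
  assumes "a * Q ^ m = 1" and "k \<le> m"
  shows   "q_pochhammer a Q k * q_pochhammer Q Q (m - k) =
             (\<Prod>j<k. - a * Q ^ j) * q_pochhammer Q Q m"
  using assms(2)
proof (induction k)
  case (Suc k)
  define i where "i = m - Suc k"
  have m: "m - k = Suc i" "m = k + Suc i"
    using Suc.prems by (auto simp: i_def)
  have "a * Q ^ k * (Q * Q ^ i) = 1"
    using assms(1) m(2) by (simp add: power_add mult_ac)
  hence "1 - a * Q ^ k = (- a * Q ^ k) * (1 - Q * Q ^ i)"
    by (simp add: algebra_simps)
  hence "q_pochhammer a Q (Suc k) * q_pochhammer Q Q i =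
           (- a * Q ^ k) * (q_pochhammer a Q k * q_pochhammer Q Q (m - k))"
    by (simp add: q_pochhammer_Suc m(1) mult_ac)
  also have "\<dots> = (\<Prod>j<Suc k. - a * Q ^ j) * q_pochhammer Q Q m"
    using Suc by (simp add: mult_ac)
  finally show ?case by (simp add: i_def)
qed simp

text \<open>
  Only even powers of \<open>(a;Q)\<^sub>k\<close> occur in the sums, so the sign is lost and the exponent
  \<open>k(k-1)/2\<close> is doubled; completing \<open>k\<^sup>2\<close> to \<open>mk\<close> then lets \<open>a Q\<^sup>m = 1\<close> absorb every power
  of \<open>Q\<close> except the one symmetric in \<open>k\<close> and \<open>m - k\<close> and the single \<open>Q\<^sup>k\<close>.
\<close>
lemma reflection_factor_square:
  fixes a Q :: "'a :: field"
  assumes "a * Q ^ m = 1" and "k \<le> m"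
  shows   "(\<Prod>j<k. - a * Q ^ j) ^ 2 * Q ^ (k * (m - k)) * Q ^ k = a ^ k"
proof -
  have sq: "(\<Prod>j<k. - a * Q ^ j) ^ 2 * Q ^ k = a ^ (2 * k) * Q ^ (k * k)"
  proof (induction k)
    case (Suc k)
    have "(\<Prod>j<Suc k. - a * Q ^ j) ^ 2 * Q ^ Suc k =
            ((\<Prod>j<k. - a * Q ^ j) ^ 2 * Q ^ k) * (a ^ 2 * (Q ^ k) ^ 2 * Q)"
      by (simp add: power_mult_distrib mult_ac)
    also have "\<dots> = a ^ (2 * Suc k) * Q ^ (Suc k * Suc k)"
      unfolding Suc.IH by (simp add: power_add power2_eq_square mult_ac)
    finally show ?case .
  qed simp
  have "(\<Prod>j<k. - a * Q ^ j) ^ 2 * Q ^ (k * (m - k)) * Q ^ k =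
          ((\<Prod>j<k. - a * Q ^ j) ^ 2 * Q ^ k) * Q ^ (k * (m - k))"
    by (simp only: mult_ac)
  also have "\<dots> = a ^ (2 * k) * Q ^ (k * k + k * (m - k))"
    unfolding sq by (simp only: power_add mult.assoc)
  also have "k * k + k * (m - k) = m * k"
    using assms(2) by (simp add: add_mult_distrib2[symmetric])
  also have "a ^ (2 * k) * Q ^ (m * k) = a ^ k * (a * Q ^ m) ^ k"
    by (simp only: mult_2 power_add power_mult power_mult_distrib mult.assoc)
  finally show ?thesis using assms(1) by simp
qed

definition q_binomial :: "'a :: field \<Rightarrow> nat \<Rightarrow> nat \<Rightarrow> 'a" where
  "q_binomial Q m k = q_pochhammer Q Q m / (q_pochhammer Q Q k * q_pochhammer Q Q (m - k))"

lemma q_binomial_symmetric: "k \<le> m \<Longrightarrow> q_binomial Q m (m - k) = q_binomial Q m k"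
  by (simp add: q_binomial_def mult.commute)

text \<open>
  The hypothesis on \<open>w\<close> is what makes the factors that are not invariant under \<open>k \<mapsto> m - k\<close>
  collapse into the difference \<open>Q\<^bsup>m-k\<^esup> - Q\<^sup>k\<close>.
\<close>
lemma well_poised_term:
  fixes a Q w :: "'a :: field"
  assumes aQ: "a * Q ^ m = 1" and w: "w * a ^ N * Q = Q ^ N"
    and Q: "Q \<noteq> 0" "\<And>j. 0 < j \<Longrightarrow> j \<le> m \<Longrightarrow> Q ^ j \<noteq> 1" and k: "k \<le> m"
  shows "(1 - a * Q ^ (2 * k)) *
           (q_pochhammer a Q k ^ (2 * N) / q_pochhammer Q Q k ^ (2 * N)) * w ^ k =
         (Q ^ (m - k) - Q ^ k) * (q_binomial Q m k ^ (2 * N) / (Q ^ m * Q ^ (N * (k * (m - k)))))"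
proof -
  define R where "R = q_pochhammer a Q k / q_pochhammer Q Q k"
  define B where "B = q_binomial Q m k"
  define s where "s = (\<Prod>j<k. - a * Q ^ j)"
  define e where "e = k * (m - k)"
  have nz: "q_pochhammer Q Q i \<noteq> 0" if "i \<le> m" for i
    using that by (intro q_pochhammer_self_nonzero Q(2)) auto
  have "R = s * B"
    using q_pochhammer_reflection[OF aQ k] nz[of k] nz[of "m - k"] k
    by (simp add: R_def B_def q_binomial_def s_def field_simps)
  hence "R ^ 2 * Q ^ e * Q ^ k = (s ^ 2 * Q ^ e * Q ^ k) * B ^ 2"
    by (simp add: power_mult_distrib mult_ac)
  also have "\<dots> = a ^ k * B ^ 2"
    using reflection_factor_square[OF aQ k] by (simp add: s_def e_def)
  finally have "(R ^ 2 * Q ^ e * Q ^ k) ^ N * (w ^ k * Q ^ k) = (a ^ k * B ^ 2) ^ N * (w ^ k * Q ^ k)"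
    by simp
  also have "\<dots> = (w * a ^ N * Q) ^ k * B ^ (2 * N)"
    by (simp add: power_mult_distrib power_mult[symmetric] mult_ac)
  also have "\<dots> = (Q ^ k) ^ N * B ^ (2 * N)"
    unfolding w by (simp add: mult.commute flip: power_mult)
  finally have "(Q ^ k) ^ N * (R ^ (2 * N) * w ^ k * Q ^ (N * e) * Q ^ k) =
                  (Q ^ k) ^ N * B ^ (2 * N)"
    by (simp add: power_mult_distrib power_mult[symmetric] mult_ac)
  hence R: "R ^ (2 * N) * w ^ k * Q ^ (N * e) * Q ^ k = B ^ (2 * N)"
    using Q(1) by simp
  have "(1 - a * Q ^ (2 * k)) * Q ^ m = Q ^ m - (a * Q ^ m) * Q ^ (2 * k)"
    by (simp add: algebra_simps)
  also have "\<dots> = Q ^ k * (Q ^ (m - k) - Q ^ k)"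
    using k by (simp add: aQ right_diff_distrib mult_2 flip: power_add)
  finally have "(1 - a * Q ^ (2 * k)) * R ^ (2 * N) * w ^ k * (Q ^ m * Q ^ (N * e)) =
                  (Q ^ (m - k) - Q ^ k) * (R ^ (2 * N) * w ^ k * Q ^ (N * e) * Q ^ k)"
    by (simp add: mult_ac)
  hence "(1 - a * Q ^ (2 * k)) * R ^ (2 * N) * w ^ k =
           (Q ^ (m - k) - Q ^ k) * (B ^ (2 * N) / (Q ^ m * Q ^ (N * e)))"
    unfolding R using Q(1) by (simp add: field_simps)
  thus ?thesis by (simp add: R_def B_def e_def power_divide)
qed

text \<open>
  The terms with \<open>k > m\<close> contain the factor \<open>1 - a Q\<^sup>m\<close> in their numerator, and the reversal
  \<open>k \<mapsto> m - k\<close> shows that the rest of the sum equals its own negative.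
\<close>
lemma well_poised_sum_eq_0:
  fixes a Q w :: "'a :: field_char_0"
  assumes aQ: "a * Q ^ m = 1" and w: "w * a ^ N * Q = Q ^ N"
    and Q: "Q \<noteq> 0" "\<And>j. 0 < j \<Longrightarrow> j < n \<Longrightarrow> Q ^ j \<noteq> 1" and mn: "m < n" and N: "N > 0"
  shows "(\<Sum>k=0..n-1. (1 - a * Q ^ (2 * k)) *
            (q_pochhammer a Q k ^ (2 * N) / q_pochhammer Q Q k ^ (2 * N)) * w ^ k) = 0"
    (is "(\<Sum>k=0..n-1. ?t k) = 0")
proof -
  have "?t k = 0" if "k > m" for k
  proof -
    have "q_pochhammer a Q k = 0"
      using aQ that by (auto simp: q_pochhammer_def prod_zero_iff)
    thus ?thesis using N by simp
  qed
  hence "(\<Sum>k=0..n-1. ?t k) = (\<Sum>k=0..m. ?t k)"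
    using mn by (intro sum.mono_neutral_right) auto
  moreover have "(\<Sum>k=0..m. ?t k) = - (\<Sum>k=0..m. ?t k)"
  proof -
    have anti: "?t (m - k) = - ?t k" if "k \<le> m" for k
    proof -
      define c where "c i = q_binomial Q m i ^ (2 * N) / (Q ^ m * Q ^ (N * (i * (m - i))))" for i
      have t: "?t i = (Q ^ (m - i) - Q ^ i) * c i" if "i \<le> m" for i
        unfolding c_def using that mn by (intro well_poised_term aQ w Q) auto
      have "c (m - k) = c k"
        using that by (simp add: c_def q_binomial_symmetric mult.commute)
      hence "?t (m - k) = (Q ^ k - Q ^ (m - k)) * c k"
        using t[of "m - k"] that by (simp only: diff_le_self diff_diff_cancel)
      also have "\<dots> = - ((Q ^ (m - k) - Q ^ k) * c k)"
        by (simp add: algebra_simps)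
      finally show ?thesis by (simp only: t[OF that])
    qed
    have "(\<Sum>k=0..m. ?t k) = (\<Sum>k=0..m. ?t (m - k))"
      using sum.atLeastAtMost_rev[of ?t 0 m] by simp
    also have "\<dots> = (\<Sum>k=0..m. - ?t k)"
      using anti by (intro sum.cong) auto
    finally show ?thesis by (simp add: sum_negf)
  qed
  ultimately show ?thesis by simp
qed

section \<open>Values of rational functions at complex numbers\<close>

abbreviation poly_at :: "complex \<Rightarrow> rat poly \<Rightarrow> complex" where
  "poly_at z p \<equiv> poly (map_poly of_rat p) z"

text \<open>
  Stated with a common multiple instead of a quotient, so that the fraction need not be in lowest
  terms and no division occurs.
\<close>
definition has_value_at :: "complex \<Rightarrow> ratfun \<Rightarrow> complex \<Rightarrow> bool" where
  "has_value_at z f v \<longleftrightarrow>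
     (\<exists>p r. f * to_fract r = to_fract p \<and> poly_at z r \<noteq> 0 \<and> poly_at z p = v * poly_at z r)"

lemma map_poly_of_rat_1: "map_poly of_rat 1 = (1 :: 'a :: field_char_0 poly)"
  by (rule poly_eqI) (simp add: coeff_map_poly)

lemma map_poly_of_rat_diff:
  "map_poly of_rat (p - r) = (map_poly of_rat p - map_poly of_rat r :: 'a :: field_char_0 poly)"
  by (rule poly_eqI) (simp add: coeff_map_poly of_rat_diff)

lemma has_value_at_poly: "has_value_at z (to_fract p) (poly_at z p)"
  unfolding has_value_at_def by (rule exI[of _ p], rule exI[of _ 1]) (simp add: map_poly_of_rat_1)

lemma has_value_at_0: "has_value_at z 0 0"
  using has_value_at_poly[of z 0] by simp

lemma has_value_at_1: "has_value_at z 1 1"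
  using has_value_at_poly[of z 1] by (simp add: map_poly_of_rat_1)

lemma has_value_at_q_var: "has_value_at z q_var z"
  using has_value_at_poly[of z "[:0, 1:]"] by (simp add: q_var_def map_poly_pCons)

lemma has_value_at_mult:
  assumes "has_value_at z f v" "has_value_at z g u"
  shows   "has_value_at z (f * g) (v * u)"
proof -
  obtain p r where f: "f * to_fract r = to_fract p" "poly_at z r \<noteq> 0"
      "poly_at z p = v * poly_at z r"
    using assms(1) by (auto simp: has_value_at_def)
  obtain p' r' where g: "g * to_fract r' = to_fract p'" "poly_at z r' \<noteq> 0"
      "poly_at z p' = u * poly_at z r'"
    using assms(2) by (auto simp: has_value_at_def)
  have "f * g * to_fract (r * r') = (f * to_fract r) * (g * to_fract r')"
    by (simp add: mult_ac)
  also have "\<dots> = to_fract (p * p')"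
    by (simp add: f g)
  finally show ?thesis
    unfolding has_value_at_def using f(2,3) g(2,3)
    by (intro exI[of _ "p * p'"] exI[of _ "r * r'"]) (simp add: map_poly_of_rat_mult)
qed

lemma has_value_at_add:
  assumes "has_value_at z f v" "has_value_at z g u"
  shows   "has_value_at z (f + g) (v + u)"
proof -
  obtain p r where f: "f * to_fract r = to_fract p" "poly_at z r \<noteq> 0"
      "poly_at z p = v * poly_at z r"
    using assms(1) by (auto simp: has_value_at_def)
  obtain p' r' where g: "g * to_fract r' = to_fract p'" "poly_at z r' \<noteq> 0"
      "poly_at z p' = u * poly_at z r'"
    using assms(2) by (auto simp: has_value_at_def)
  have "(f + g) * to_fract (r * r') =
          (f * to_fract r) * to_fract r' + (g * to_fract r') * to_fract r"
    by (simp add: algebra_simps)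
  also have "\<dots> = to_fract (p * r' + p' * r)"
    by (simp add: f g)
  finally show ?thesis
    unfolding has_value_at_def using f(2,3) g(2,3)
    by (intro exI[of _ "p * r' + p' * r"] exI[of _ "r * r'"])
       (simp add: map_poly_of_rat_mult map_poly_of_rat_add algebra_simps)
qed

lemma has_value_at_diff:
  assumes "has_value_at z f v" "has_value_at z g u"
  shows   "has_value_at z (f - g) (v - u)"
proof -
  have "has_value_at z (- 1) (- 1)"
    using has_value_at_poly[of z "- 1"] map_poly_of_rat_diff[of 0 1, where ?'a = complex]
    by (simp add: map_poly_of_rat_1)
  from has_value_at_add[OF assms(1) has_value_at_mult[OF this assms(2)]] show ?thesis by simp
qed

lemma has_value_at_inverse:
  assumes "has_value_at z f v" "v \<noteq> 0"
  shows   "has_value_at z (inverse f) (inverse v)"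
proof -
  obtain p r where f: "f * to_fract r = to_fract p" "poly_at z r \<noteq> 0"
      "poly_at z p = v * poly_at z r"
    using assms(1) by (auto simp: has_value_at_def)
  have "p \<noteq> 0" using f assms(2) by auto
  hence "f \<noteq> 0" using f(1) by auto
  hence "inverse f * to_fract p = to_fract r"
    using f(1) by (simp add: field_simps)
  thus ?thesis
    unfolding has_value_at_def using f(2,3) assms(2)
    by (intro exI[of _ r] exI[of _ p]) simp
qed

lemma has_value_at_divide:
  assumes "has_value_at z f v" "has_value_at z g u" "u \<noteq> 0"
  shows   "has_value_at z (f / g) (v / u)"
  using has_value_at_mult[OF assms(1) has_value_at_inverse[OF assms(2,3)]]
  by (simp add: divide_inverse)

lemma has_value_at_power:
  "has_value_at z f v \<Longrightarrow> has_value_at z (f ^ k) (v ^ k)"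
  by (induction k) (auto intro: has_value_at_1 has_value_at_mult)

lemma has_value_at_power_int:
  assumes "has_value_at z f v" "v \<noteq> 0"
  shows   "has_value_at z (f powi i) (v powi i)"
  using assms by (auto simp: power_int_def intro!: has_value_at_power has_value_at_inverse)

lemma has_value_at_sum:
  "(\<And>x. x \<in> A \<Longrightarrow> has_value_at z (f x) (v x)) \<Longrightarrow> has_value_at z (sum f A) (sum v A)"
  by (induction A rule: infinite_finite_induct) (auto intro: has_value_at_0 has_value_at_add)

lemma has_value_at_q_pochhammer:
  assumes "has_value_at z f v" "has_value_at z g u"
  shows   "has_value_at z (q_pochhammer f g k) (q_pochhammer v u k)"
  by (induction k)
     (auto simp: q_pochhammer_Suc
           intro!: has_value_at_mult has_value_at_diff has_value_at_1 has_value_at_power assms)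

lemma has_value_at_q_int:
  assumes "z \<noteq> 0" "z \<noteq> 1"
  shows   "has_value_at z (q_int i) ((1 - z powi i) / (1 - z))"
  unfolding q_int_def using assms
  by (intro has_value_at_divide has_value_at_diff has_value_at_1 has_value_at_power_int
        has_value_at_q_var) auto

lemma has_value_at_0_imp_numerator_root:
  assumes "has_value_at z f 0"
  shows   "poly_at z (fst (quot_of_fract f)) = 0"
proof -
  define s t where "s = fst (quot_of_fract f)" and "t = snd (quot_of_fract f)"
  obtain p r where f: "f * to_fract r = to_fract p" "poly_at z r \<noteq> 0" "poly_at z p = 0"
    using assms by (auto simp: has_value_at_def)
  have "f = Fract s t" by (simp add: s_def t_def)
  moreover have "t \<noteq> 0" by (simp add: t_def)
  ultimately have "to_fract s = f * to_fract t"
    by (simp add: Fract_conv_to_fract)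
  hence "to_fract (s * r) = to_fract (p * t)"
    using f(1) by (simp add: mult_ac)
  hence "s * r = p * t" by (simp only: to_fract_eq_iff)
  hence "poly_at z s * poly_at z r = poly_at z p * poly_at z t"
    by (metis map_poly_of_rat_mult poly_mult)
  thus ?thesis using f(2,3) by (simp add: s_def)
qed

section \<open>Divisibility by cyclotomic polynomials\<close>

lemma prod_linear_factors_dvd:
  fixes p :: "'a :: idom poly"
  assumes "finite A" "inj_on x A" "\<And>k. k \<in> A \<Longrightarrow> poly p (x k) = 0"
  shows   "(\<Prod>k\<in>A. [:- x k, 1:]) dvd p"
  using assms
proof (induction A arbitrary: p rule: finite_induct)
  case (insert k A)
  obtain s where s: "p = [:- x k, 1:] * s"
    using insert.prems(2)[of k] by (auto simp: poly_eq_0_iff_dvd)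
  have "poly s (x j) = 0" if "j \<in> A" for j
  proof -
    have "x j \<noteq> x k"
      using insert.prems(1) insert.hyps(2) that by (auto simp: inj_on_def)
    thus ?thesis using insert.prems(2)[of j] that s by auto
  qed
  hence "(\<Prod>k\<in>A. [:- x k, 1:]) dvd s"
    using insert.prems(1) by (intro insert.IH) auto
  thus ?case using insert.hyps s by (simp add: mult_dvd_mono del: mult_pCons_left)
qed auto

text \<open>
  Division with remainder is the same over both fields, so the remainder of \<open>p\<close> by \<open>r\<close> is
  already computed over the rationals.
\<close>
lemma map_poly_of_rat_dvd_imp_dvd:
  fixes p r :: "rat poly"
  assumes "(map_poly of_rat r :: 'a :: field_char_0 poly) dvd map_poly of_rat p"
  shows   "r dvd p"
proof (cases "r = 0")
  case True
  thus ?thesis using assms map_poly_of_rat_inject[of p 0, where ?'a = 'a] by simp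
next
  case False
  let ?h = "map_poly of_rat :: rat poly \<Rightarrow> 'a poly"
  have "?h p = ?h r * ?h (p div r) + ?h (p mod r)"
    by (metis map_poly_of_rat_add map_poly_of_rat_mult mult_div_mod_eq)
  hence dvd: "?h r dvd ?h (p mod r)"
    using assms by (simp add: dvd_add_right_iff)
  have "p mod r = 0"
  proof (rule ccontr)
    assume nz: "p mod r \<noteq> 0"
    hence "?h (p mod r) \<noteq> 0"
      using map_poly_of_rat_inject[of "p mod r" 0, where ?'a = 'a] by simp
    hence "degree r \<le> degree (p mod r)"
      using dvd_imp_degree_le[OF dvd] by (simp add: degree_map_poly_of_rat)
    thus False using degree_mod_less'[OF False nz] by simp
  qed
  thus ?thesis by auto
qed

lemma cis_power_eq_1_iff:
  assumes "n > 0"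
  shows   "cis (2 * pi / real n) ^ j = 1 \<longleftrightarrow> n dvd j"
proof
  assume "n dvd j"
  then obtain c where "j = n * c" ..
  thus "cis (2 * pi / real n) ^ j = 1"
    using assms by (simp add: DeMoivre power_mult)
next
  assume "cis (2 * pi / real n) ^ j = 1"
  then obtain i :: int where "real j * (2 * pi / real n) = of_int i * (2 * pi)"
    by (auto simp: DeMoivre cis_eq_1_iff)
  hence "real j = of_int i * real n"
    using assms by (simp add: field_simps)
  hence "of_int (int j) = (of_int (i * int n) :: real)"
    by simp
  hence "int j = i * int n"
    by (simp only: of_int_eq_iff)
  hence "int n dvd int j" by simp
  thus "n dvd j" by simp
qed

text \<open>
  The quantified condition on \<open>z\<close> says that \<open>z\<close> is a primitive \<open>n\<close>-th root of unity. These are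
  distinct simple roots of \<open>\<Phi>\<^sub>n\<close>, so it suffices that the numerator vanishes at each of them.
\<close>
lemma ratfun_cong_cyclotomicI:
  assumes n: "n > 0"
    and "\<And>z. (\<And>j. z ^ j = 1 \<longleftrightarrow> n dvd j) \<Longrightarrow> has_value_at z f 0"
  shows "ratfun_cong f 0 (cyclotomic n)"
proof -
  let ?c = "cis (2 * pi / real n)"
  let ?A = "{k. k \<in> {1..n} \<and> coprime n k}"
  have "inj_on (\<lambda>k. ?c ^ k) ?A"
  proof (rule linorder_inj_onI')
    fix i j assume ij: "i \<in> ?A" "j \<in> ?A" "i < j"
    show "?c ^ i \<noteq> ?c ^ j"
    proof
      assume "?c ^ i = ?c ^ j"
      moreover have "?c ^ j = ?c ^ i * ?c ^ (j - i)"
        using ij(3) by (simp flip: power_add)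
      ultimately have "?c ^ (j - i) = 1" by simp
      hence "n dvd j - i" using n by (simp add: cis_power_eq_1_iff)
      thus False using ij by (auto dest!: dvd_imp_le)
    qed
  qed
  moreover have "poly_at (?c ^ k) (fst (quot_of_fract f)) = 0" if "k \<in> ?A" for k
  proof (intro has_value_at_0_imp_numerator_root assms(2))
    fix j show "(?c ^ k) ^ j = 1 \<longleftrightarrow> n dvd j"
      using that n by (simp add: cis_power_eq_1_iff coprime_dvd_mult_right_iff flip: power_mult)
  qed
  ultimately have "cyclotomic_complex n dvd map_poly of_rat (fst (quot_of_fract f))"
    unfolding cyclotomic_complex_def by (intro prod_linear_factors_dvd) auto
  hence "cyclotomic n dvd fst (quot_of_fract f)"
    using n by (intro map_poly_of_rat_dvd_imp_dvd[where ?'a = complex]) (simp add: of_rat_cyclotomic)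
  thus ?thesis by (simp add: ratfun_cong_def)
qed

section \<open>The congruences\<close>

lemma power_of_coprime_power_exists:
  fixes z :: "'a :: field"
  assumes "coprime d n" "n > 0" "z ^ n = 1"
  shows   "\<exists>m<n. (z ^ d) ^ m = z ^ s"
proof -
  have mod: "z ^ (i mod n) = z ^ i" for i
  proof -
    have "z ^ i = z ^ (n * (i div n) + i mod n)" by simp
    also have "\<dots> = z ^ (i mod n)" by (simp only: power_add power_mult assms(3)) simp
    finally show ?thesis by simp
  qed
  obtain x where x: "[d * x = 1] (mod n)"
    using cong_solve_coprime_nat[OF assms(1)] by auto
  have "d * (x * s mod n) mod n = (d * x) * s mod n"
    by (simp add: mod_mult_right_eq mult.assoc)
  also have "\<dots> = s mod n"
    using cong_mult[OF x cong_refl[of s]] by (simp add: cong_def)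
  finally have "z ^ (d * (x * s mod n)) = z ^ s"
    using mod[of "d * (x * s mod n)"] mod[of s] by simp
  thus ?thesis
    using assms(2) by (intro exI[of _ "x * s mod n"]) (simp add: power_mult)
qed

text \<open>
  This covers both congruences, with \<open>e = 1\<close> and \<open>e = -1\<close>. Only the residue of \<open>e\<close> modulo \<open>n\<close>
  matters for finding \<open>m\<close>, and the equation for \<open>c\<close> is the relation \<open>w a\<^sup>d Q = Q\<^sup>d\<close> written in
  exponents of \<open>z\<close>, for \<open>a = z\<^sup>e\<close>, \<open>Q = z\<^sup>d\<close> and \<open>w = z\<^sup>c\<close>.
\<close>
lemma well_poised_sum_cong_0:
  fixes d n c :: nat and e :: int and f :: ratfun
  assumes d: "d > 0" and n: "n \<ge> 2" and coprime: "coprime d n"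
    and f: "f = q_var powi e" and c: "int c + e * int d + int d = int d * int d"
  shows "ratfun_cong
           (\<Sum>k=0..n-1. q_int (2 * int d * int k + e)
              * (q_pochhammer f (q_var ^ d) k ^ (2 * d)
                 / q_pochhammer (q_var ^ d) (q_var ^ d) k ^ (2 * d))
              * q_var ^ (c * k))
           0 (cyclotomic n)"
    (is "ratfun_cong ?F 0 _")
proof (rule ratfun_cong_cyclotomicI)
  fix z :: complex
  assume z: "z ^ j = 1 \<longleftrightarrow> n dvd j" for j
  have zn: "z ^ n = 1" using z by simp
  have z0: "z \<noteq> 0"
    using zn n by (auto simp: power_0_left)
  have z1: "z \<noteq> 1"
    using z[of 1] n by auto
  define Q where "Q = z ^ d"
  define a where "a = z powi e"
  have Q1: "Q ^ j \<noteq> 1" if "0 < j" "j < n" for j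
  proof
    assume "Q ^ j = 1"
    hence "n dvd d * j" using z by (simp add: Q_def flip: power_mult)
    hence "n dvd j"
      using coprime by (simp add: coprime_commute coprime_dvd_mult_right_iff)
    thus False using that by (auto dest: dvd_imp_le)
  qed
  let ?t = "\<lambda>k. (1 - a * Q ^ (2 * k)) *
              (q_pochhammer a Q k ^ (2 * d) / q_pochhammer Q Q k ^ (2 * d)) * (z ^ c) ^ k"
  have "(\<Sum>k=0..n-1. ?t k) = 0"
  proof -
    \<comment> \<open>The exponent \<open>s\<close> is a representative of \<open>- e\<close> modulo \<open>n\<close>.\<close>
    define s where "s = nat ((- e) mod int n)"
    obtain m where m: "m < n" "Q ^ m = z ^ s"
      using power_of_coprime_power_exists[OF coprime _ zn, of s] n by (auto simp: Q_def)
    have "int s = (- e) mod int n" using n by (simp add: s_def)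
    hence "(e + int s) mod int n = 0"
      by (simp add: mod_add_right_eq)
    then obtain i where i: "e + int s = int n * i"
      by (auto simp: mod_eq_0_iff_dvd)
    have "a * Q ^ m = z powi (e + int s)"
      using z0 by (simp add: a_def m power_int_add)
    also have "\<dots> = (z ^ n) powi i"
      by (simp add: i power_int_mult)
    finally have "a * Q ^ m = 1" by (simp add: zn)
    moreover have "z ^ c * a ^ d * Q = Q ^ d"
    proof -
      have "z ^ c * a ^ d * Q = z powi (int c + e * int d + int d)"
        using z0 by (simp add: a_def Q_def power_int_add power_int_mult)
      also have "\<dots> = Q ^ d"
        unfolding c by (simp add: Q_def power_int_mult)
      finally show ?thesis .
    qed
    ultimately show ?thesis
      using m d z0 Q1 by (intro well_poised_sum_eq_0) (auto simp: Q_def)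
  qed
  hence zero: "(\<Sum>k=0..n-1. ?t k / (1 - z)) = 0"
    by (simp only: sum_divide_distrib[symmetric] div_0)
  have "?t k / (1 - z) = (1 - z powi (2 * int d * int k + e)) / (1 - z) *
          (q_pochhammer a Q k ^ (2 * d) / q_pochhammer Q Q k ^ (2 * d)) * z ^ (c * k)" for k
  proof -
    have "z powi (2 * int d * int k + e) = z powi int (d * (2 * k)) * a"
      using z0 by (simp add: power_int_add a_def mult_ac)
    hence "a * Q ^ (2 * k) = z powi (2 * int d * int k + e)"
      by (simp only: Q_def power_int_of_nat mult.commute power_mult)
    thus ?thesis by (simp add: power_mult)
  qed
  moreover have "q_pochhammer Q Q k \<noteq> 0" if "k \<le> n - 1" for k
    using that n by (intro q_pochhammer_self_nonzero Q1) auto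
  ultimately have "has_value_at z ?F (\<Sum>k=0..n-1. ?t k / (1 - z))"
    unfolding f a_def Q_def
    by (simp only:)
       (intro has_value_at_sum has_value_at_mult has_value_at_divide has_value_at_q_int
          has_value_at_power has_value_at_power_int has_value_at_q_pochhammer has_value_at_q_var
          power_not_zero z0 z1; simp)
  thus "has_value_at z ?F 0" by (simp only: zero)
qed (use n in simp)

theorem theorem2:
  fixes d n :: nat
  assumes "d \<ge> 3" and "n \<ge> 2" and "coprime d n"
  shows "ratfun_cong
           (\<Sum>k=0..n-1. q_int (2 * int d * int k + 1)
              * (q_pochhammer q_var (q_var ^ d) k ^ (2 * d)
                 / q_pochhammer (q_var ^ d) (q_var ^ d) k ^ (2 * d))
              * q_var ^ (d * (d - 2) * k))
           0 (cyclotomic n)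
       \<and> ratfun_cong
           (\<Sum>k=0..n-1. q_int (2 * int d * int k - 1)
              * (q_pochhammer (inverse q_var) (q_var ^ d) k ^ (2 * d)
                 / q_pochhammer (q_var ^ d) (q_var ^ d) k ^ (2 * d))
              * q_var ^ (d ^ 2 * k))
           0 (cyclotomic n)"
proof
  have "int (d * (d - 2)) + 1 * int d + int d = int d * int d"
    using assms(1) by (simp add: of_nat_diff algebra_simps)
  thus "ratfun_cong
           (\<Sum>k=0..n-1. q_int (2 * int d * int k + 1)
              * (q_pochhammer q_var (q_var ^ d) k ^ (2 * d)
                 / q_pochhammer (q_var ^ d) (q_var ^ d) k ^ (2 * d))
              * q_var ^ (d * (d - 2) * k))
           0 (cyclotomic n)"
    using assms by (intro well_poised_sum_cong_0) auto
  have "ratfun_cong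
           (\<Sum>k=0..n-1. q_int (2 * int d * int k + - 1)
              * (q_pochhammer (inverse q_var) (q_var ^ d) k ^ (2 * d)
                 / q_pochhammer (q_var ^ d) (q_var ^ d) k ^ (2 * d))
              * q_var ^ (d ^ 2 * k))
           0 (cyclotomic n)"
    using assms by (intro well_poised_sum_cong_0) (auto simp: power_int_minus power2_eq_square)
  thus "ratfun_cong
           (\<Sum>k=0..n-1. q_int (2 * int d * int k - 1)
              * (q_pochhammer (inverse q_var) (q_var ^ d) k ^ (2 * d)
                 / q_pochhammer (q_var ^ d) (q_var ^ d) k ^ (2 * d))
              * q_var ^ (d ^ 2 * k))
           0 (cyclotomic n)"
    by simp
qed

end
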